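(* Let $\lambda=(\lambda_1,\dots,\lambda_k)$ be a tuple of positive integers, $U_\lambda$ the associated orthogonal Gelfand-Zeitlin algebra, acting on the field $\Omega$ of rational functions by definition, and $\mathbf{R}=R^G\subset\Omega$ the algebra of $G$-invariant polynomials. Then $\mathbf{R}$ is invariant under the natural left action of $U_\lambda$, that is, $u\cdot f\in\mathbf{R}$ for all $u\in U_\lambda$ and $f\in\mathbf{R}$.
   Context: Let $k\ge 1$ and let $\lambda=(\lambda_1,\dots,\lambda_k)$ be positive integers. Let $I$ be the set of pairs $(i,j)$ with $1\le i\le k$, $1\le j\le \lambda_i$; for $1\le i\le k$ let $I^{(i)}=\{(i,j):1\le j\le\lambda_i\}$, and put $I^{(0)}=\emptyset$ (a product over the empty set is $1$). Let $\Omega=\mathbb{C}(x_{\mathbf a}:\mathbf a\in I)$ be the field of rational functions and $R=\mathbb{C}[x_{\mathbf a}:\mathbf a\in I]\subset\Omega$. For $\mathbf a\in I$, $\varphi_{\mathbf a}$ is the $\mathbb{C}$-automorphism of the field $\Omega$ with $\varphi_{\mathbf a}(x_{\mathbf b})=x_{\mathbf b}+\delta_{\mathbf a,\mathbf b}$ for all $\mathbf b\in I$. Elements of $\Omega$ also act on $\Omega$ by multiplication. For $i=1,\dots,k-1$ define $\mathbb{C}$-linear operators on $\Omega$ (the Gelfand-Zeitlin formulae) $$E_i=\sum_{j=1}^{\lambda_i}\frac{\prod_{\mathbf a\in I^{(i+1)}}(x_{(i,j)}-x_{\mathbf a})}{\prod_{\mathbf b\in I^{(i)}\setminus\{(i,j)\}}(x_{(i,j)}-x_{\mathbf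 b})}\varphi_{(i,j)},\qquad F_i=\sum_{j=1}^{\lambda_i}\frac{\prod_{\mathbf a\in I^{(i-1)}}(x_{(i,j)}-x_{\mathbf a})}{\prod_{\mathbf b\in I^{(i)}\setminus\{(i,j)\}}(x_{(i,j)}-x_{\mathbf b})}\varphi_{(i,j)}^{-1}.$$ For $\mathbf a=(i,j)\in I$, $\gamma_{\mathbf a}$ is multiplication by the $j$-th elementary symmetric polynomial in $\{x_{\mathbf b}:\mathbf b\in I^{(i)}\}$. The orthogonal Gelfand-Zeitlin algebra $U_\lambda$ is the subalgebra of the algebra of $\mathbb{C}$-linear transformations of $\Omega$ generated by all $E_i,F_i$ ($1\le i\le k-1$) and all $\gamma_{\mathbf a}$ ($\mathbf a\in I$). The group $G=S_{\lambda_1}\times\dots\times S_{\lambda_k}$ acts on $\Omega$ and $R$, with $S_{\lambda_i}$ permuting the variables $x_{(i,1)},\dots,x_{(i,\lambda_i)}$; $\mathbf{R}:=R^G$. *)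

theory Defs
  imports
    Complex_Main
    "HOL-Library.Poly_Mapping"
    "HOL-Library.Product_Lexorder"
    "HOL-Library.FuncSet"
    "HOL-Computational_Algebra.Fraction_Field"
    "HOL-Combinatorics.Permutations"
begin

text \<open>
  The types below provide polynomials and rational functions over the complex numbers in
  infinitely many variables, indexed by all pairs of natural numbers.  The ring \<open>R\<close> and
  the field \<open>\<Omega>\<close> in the variables indexed by the finite set \<open>I\<close> are then carrier sets inside
  these types.  The lexicographic order on pairs is only needed for the
  integral domain instance of polynomials.
\<close>

type_synonym gz_var = "nat \<times> nat"
type_synonym gz_poly = "(gz_var \<Rightarrow>\<^sub>0 nat) \<Rightarrow>\<^sub>0 complex"
type_synonym gz_rat = "gz_poly fract"

definition pconst :: "complex \<Rightarrow> gz_poly" where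
  "pconst c = Poly_Mapping.single 0 c"

definition pvar :: "gz_var \<Rightarrow> gz_poly" where
  "pvar v = Poly_Mapping.single (Poly_Mapping.single v 1) 1"

definition pvars :: "gz_poly \<Rightarrow> gz_var set" where
  "pvars p = (\<Union>m\<in>Poly_Mapping.keys p. Poly_Mapping.keys m)"

definition rconst :: "complex \<Rightarrow> gz_rat" where
  "rconst c = Fract (pconst c) 1"

definition rvar :: "gz_var \<Rightarrow> gz_rat" where
  "rvar v = Fract (pvar v) 1"

definition psubst :: "(gz_var \<Rightarrow> gz_poly) \<Rightarrow> gz_poly \<Rightarrow> gz_poly" where
  "psubst s p = (\<Sum>m\<in>Poly_Mapping.keys p.
     pconst (Poly_Mapping.lookup p m) * (\<Prod>v\<in>Poly_Mapping.keys m. s v ^ Poly_Mapping.lookup m v))"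

text \<open>
  Substitution in a rational function, numerator and denominator separately.  It is well defined
  whenever \<^term>\<open>psubst s\<close> is injective, which covers all uses below
  (see \<open>rsubst_Fract\<close>).
\<close>

definition rsubst :: "(gz_var \<Rightarrow> gz_poly) \<Rightarrow> gz_rat \<Rightarrow> gz_rat" where
  "rsubst s r = (THE y. \<exists>p q. q \<noteq> 0 \<and> r = Fract p q \<and> y = Fract (psubst s p) (psubst s q))"

text \<open>
  A tuple \<open>\<lambda> = (\<lambda>\<^sub>1, \<dots>, \<lambda>\<^sub>k)\<close> is given by its length \<open>k\<close> and a function \<open>lam\<close>, of which only the
  values on \<open>{1..k}\<close> matter.
\<close>

definition gz_row :: "(nat \<Rightarrow> nat) \<Rightarrow> nat \<Rightarrow> gz_var set" where
  "gz_row lam i = (if i = 0 then {} else {i} \<times> {1..lam i})"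

definition gz_index :: "nat \<Rightarrow> (nat \<Rightarrow> nat) \<Rightarrow> gz_var set" where
  "gz_index k lam = {(i, j). 1 \<le> i \<and> i \<le> k \<and> 1 \<le> j \<and> j \<le> lam i}"

definition gz_Omega :: "nat \<Rightarrow> (nat \<Rightarrow> nat) \<Rightarrow> gz_rat set" where
  "gz_Omega k lam =
     {Fract p q | p q. q \<noteq> 0 \<and> pvars p \<subseteq> gz_index k lam \<and> pvars q \<subseteq> gz_index k lam}"

definition gz_R :: "nat \<Rightarrow> (nat \<Rightarrow> nat) \<Rightarrow> gz_rat set" where
  "gz_R k lam = {Fract p 1 | p. pvars p \<subseteq> gz_index k lam}"

text \<open>
  An element of \<open>S\<^bsub>\<lambda>\<^sub>1\<^esub> \<times> \<dots> \<times> S\<^bsub>\<lambda>\<^sub>k\<^esub>\<close> is a family of permutations indexed by \<open>{1..k}\<close>; it sends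
  \<open>x\<^bsub>(i,j)\<^esub>\<close> to \<open>x\<^bsub>(i,g\<^sub>i(j))\<^esub>\<close>.
\<close>

definition gz_G :: "nat \<Rightarrow> (nat \<Rightarrow> nat) \<Rightarrow> (nat \<Rightarrow> nat \<Rightarrow> nat) set" where
  "gz_G k lam = (\<Pi>\<^sub>E i\<in>{1..k}. {\<pi>. \<pi> permutes {1..lam i}})"

definition gz_perm :: "nat \<Rightarrow> (nat \<Rightarrow> nat \<Rightarrow> nat) \<Rightarrow> gz_var \<Rightarrow> gz_var" where
  "gz_perm k g = (\<lambda>(i, j). if i \<in> {1..k} then (i, g i j) else (i, j))"

definition gz_act :: "nat \<Rightarrow> (nat \<Rightarrow> nat \<Rightarrow> nat) \<Rightarrow> gz_rat \<Rightarrow> gz_rat" where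
  "gz_act k g = rsubst (\<lambda>v. pvar (gz_perm k g v))"

definition gz_invariants :: "nat \<Rightarrow> (nat \<Rightarrow> nat) \<Rightarrow> gz_rat set" where
  "gz_invariants k lam = {f \<in> gz_R k lam. \<forall>g\<in>gz_G k lam. gz_act k g f = f}"

text \<open>
  A transformation of \<open>\<Omega>\<close> is represented by the function that is
  \<^const>\<open>undefined\<close> outside \<open>\<Omega>\<close>, so that equality of transformations is equality of functions.
\<close>

definition gz_End :: "nat \<Rightarrow> (nat \<Rightarrow> nat) \<Rightarrow> (gz_rat \<Rightarrow> gz_rat) set" where
  "gz_End k lam = {T \<in> gz_Omega k lam \<rightarrow>\<^sub>E gz_Omega k lam.
     (\<forall>f\<in>gz_Omega k lam. \<forall>g\<in>gz_Omega k lam. T (f + g) = T f + T g) \<and>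
     (\<forall>c. \<forall>f\<in>gz_Omega k lam. T (rconst c * f) = rconst c * T f)}"

definition gz_subalgebra :: "nat \<Rightarrow> (nat \<Rightarrow> nat) \<Rightarrow> (gz_rat \<Rightarrow> gz_rat) set \<Rightarrow> bool" where
  "gz_subalgebra k lam A \<longleftrightarrow>
     A \<subseteq> gz_End k lam \<and>
     (\<lambda>f\<in>gz_Omega k lam. f) \<in> A \<and>
     (\<forall>S\<in>A. \<forall>T\<in>A. (\<lambda>f\<in>gz_Omega k lam. S f + T f) \<in> A) \<and>
     (\<forall>c. \<forall>T\<in>A. (\<lambda>f\<in>gz_Omega k lam. rconst c * T f) \<in> A) \<and>
     (\<forall>S\<in>A. \<forall>T\<in>A. compose (gz_Omega k lam) S T \<in> A)"

definition gz_phi :: "gz_var \<Rightarrow> gz_rat \<Rightarrow> gz_rat" where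
  "gz_phi a = rsubst (\<lambda>b. pvar b + (if a = b then 1 else 0))"

definition gz_E :: "nat \<Rightarrow> (nat \<Rightarrow> nat) \<Rightarrow> nat \<Rightarrow> gz_rat \<Rightarrow> gz_rat" where
  "gz_E k lam i = (\<lambda>f\<in>gz_Omega k lam. \<Sum>j = 1..lam i.
     (\<Prod>a\<in>gz_row lam (i + 1). rvar (i, j) - rvar a) /
     (\<Prod>b\<in>gz_row lam i - {(i, j)}. rvar (i, j) - rvar b) *
     gz_phi (i, j) f)"

definition gz_F :: "nat \<Rightarrow> (nat \<Rightarrow> nat) \<Rightarrow> nat \<Rightarrow> gz_rat \<Rightarrow> gz_rat" where
  "gz_F k lam i = (\<lambda>f\<in>gz_Omega k lam. \<Sum>j = 1..lam i.
     (\<Prod>a\<in>gz_row lam (i - 1). rvar (i, j) - rvar a) /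
     (\<Prod>b\<in>gz_row lam i - {(i, j)}. rvar (i, j) - rvar b) *
     inv_into (gz_Omega k lam) (gz_phi (i, j)) f)"

definition elem_sym :: "nat \<Rightarrow> gz_var set \<Rightarrow> gz_rat" where
  "elem_sym j V = (\<Sum>S | S \<subseteq> V \<and> card S = j. \<Prod>b\<in>S. rvar b)"

definition gz_gamma :: "nat \<Rightarrow> (nat \<Rightarrow> nat) \<Rightarrow> gz_var \<Rightarrow> gz_rat \<Rightarrow> gz_rat" where
  "gz_gamma k lam = (\<lambda>(i, j). \<lambda>f\<in>gz_Omega k lam. elem_sym j (gz_row lam i) * f)"

definition gz_generators :: "nat \<Rightarrow> (nat \<Rightarrow> nat) \<Rightarrow> (gz_rat \<Rightarrow> gz_rat) set" where
  "gz_generators k lam =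
     gz_E k lam ` {1..<k} \<union> gz_F k lam ` {1..<k} \<union> gz_gamma k lam ` gz_index k lam"

definition gz_algebra :: "nat \<Rightarrow> (nat \<Rightarrow> nat) \<Rightarrow> (gz_rat \<Rightarrow> gz_rat) set" where
  "gz_algebra k lam = gz_subalgebra k lam hull gz_generators k lam"

lemma pconst_simps:
  "pconst 0 = 0" "pconst 1 = 1" "pconst (c + d) = pconst c + pconst d"
  "pconst (c * d) = pconst c * pconst d"
  by (simp_all add: pconst_def single_add mult_single)

lemma pvar_power: "pvar v ^ n = Poly_Mapping.single (Poly_Mapping.single v n) 1"
  by (induction n) (simp_all add: pvar_def mult_single flip: single_add)

lemma single_prod: "finite V \<Longrightarrow> (\<Prod>v\<in>V. Poly_Mapping.single (m v) (1::complex))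
    = Poly_Mapping.single (\<Sum>v\<in>V. m v :: gz_var \<Rightarrow>\<^sub>0 nat) 1"
  by (induction V rule: finite_induct) (simp_all add: mult_single)

lemma single_eq_prod: "Poly_Mapping.single m c = pconst c *
    (\<Prod>v\<in>Poly_Mapping.keys m. pvar v ^ Poly_Mapping.lookup m v)"
proof -
  have "m = (\<Sum>v\<in>Poly_Mapping.keys m. Poly_Mapping.single v (Poly_Mapping.lookup m v))"
    by (rule poly_mapping_eqI)
       (auto simp: lookup_sum lookup_single when_def in_keys_iff)
  then have "(\<Prod>v\<in>Poly_Mapping.keys m. pvar v ^ Poly_Mapping.lookup m v) = Poly_Mapping.single m 1"
    by (simp add: pvar_power single_prod)
  then show ?thesis by (simp add: pconst_def mult_single)
qed

lemma poly_eq_sum: "p = (\<Sum>m\<in>Poly_Mapping.keys p. Poly_Mapping.single m (Poly_Mapping.lookup p m))"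
  by (rule poly_mapping_eqI) (auto simp: lookup_sum lookup_single when_def in_keys_iff)

lemma psubst_pvar_id: "psubst pvar p = p"
  unfolding psubst_def single_eq_prod[symmetric] poly_eq_sum[symmetric] ..

lemma psubst_add: "psubst s (p + q) = psubst s p + psubst s q"
  unfolding psubst_def
  by (rule setsum_keys_plus_distrib) (simp_all add: pconst_simps ring_distribs)

lemma psubst_zero: "psubst s 0 = 0"
  by (simp add: psubst_def)

lemma psubst_sum: "psubst s (\<Sum>i\<in>A. p i) = (\<Sum>i\<in>A. psubst s (p i))"
  by (induction A rule: infinite_finite_induct) (simp_all add: psubst_add psubst_zero)

lemma psubst_single: "psubst s (Poly_Mapping.single m c) =
    pconst c * (\<Prod>v\<in>Poly_Mapping.keys m. s v ^ Poly_Mapping.lookup m v)"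
  by (simp add: psubst_def pconst_simps)

lemma monomial_value_add:
  fixes s :: "gz_var \<Rightarrow> gz_poly"
  shows "(\<Prod>v\<in>Poly_Mapping.keys (m + n). s v ^ Poly_Mapping.lookup (m + n) v) =
    (\<Prod>v\<in>Poly_Mapping.keys m. s v ^ Poly_Mapping.lookup m v) *
    (\<Prod>v\<in>Poly_Mapping.keys n. s v ^ Poly_Mapping.lookup n v)"
proof -
  define K where "K = Poly_Mapping.keys m \<union> Poly_Mapping.keys n"
  have ext: "(\<Prod>v\<in>Poly_Mapping.keys l. s v ^ Poly_Mapping.lookup l v) =
      (\<Prod>v\<in>K. s v ^ Poly_Mapping.lookup l v)" if "Poly_Mapping.keys l \<subseteq> K" for l
    by (rule prod.mono_neutral_left) (use that in \<open>auto simp: K_def in_keys_iff\<close>)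
  have "Poly_Mapping.keys (m + n) \<subseteq> K"
    unfolding K_def by (rule Poly_Mapping.keys_add)
  then show ?thesis
    by (simp add: ext) (simp add: ext K_def lookup_add power_add prod.distrib)
qed

lemma psubst_mult: "psubst s (p * q) = psubst s p * psubst s q"
proof -
  have "psubst s (p * q) = psubst s
      ((\<Sum>m\<in>Poly_Mapping.keys p. Poly_Mapping.single m (Poly_Mapping.lookup p m)) *
       (\<Sum>n\<in>Poly_Mapping.keys q. Poly_Mapping.single n (Poly_Mapping.lookup q n)))"
    using poly_eq_sum[of p] poly_eq_sum[of q] by simp
  also have "\<dots> = (\<Sum>m\<in>Poly_Mapping.keys p. \<Sum>n\<in>Poly_Mapping.keys q.
      psubst s (Poly_Mapping.single m (Poly_Mapping.lookup p m)) *
      psubst s (Poly_Mapping.single n (Poly_Mapping.lookup q n)))"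
    unfolding sum_product psubst_sum mult_single psubst_single monomial_value_add pconst_simps
    by (simp add: mult_ac)
  also have "\<dots> = psubst s p * psubst s q"
    unfolding sum_product[symmetric] psubst_sum[symmetric] poly_eq_sum[symmetric] ..
  finally show ?thesis .
qed

lemma psubst_pconst: "psubst s (pconst c) = pconst c"
  unfolding pconst_def psubst_single by (simp add: pconst_def)

lemma psubst_one: "psubst s 1 = 1"
  using psubst_pconst[of s 1] by (simp add: pconst_simps)

lemma psubst_pvar: "psubst s (pvar v) = s v"
  unfolding pvar_def psubst_single by (simp add: pconst_simps)

lemma psubst_power: "psubst s (p ^ n) = psubst s p ^ n"
  by (induction n) (simp_all add: psubst_one psubst_mult)

lemma psubst_prod: "psubst s (\<Prod>i\<in>A. p i) = (\<Prod>i\<in>A. psubst s (p i))"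
  by (induction A rule: infinite_finite_induct) (simp_all add: psubst_mult psubst_one)

lemma psubst_psubst: "psubst t (psubst s p) = psubst (\<lambda>v. psubst t (s v)) p"
  by (simp add: psubst_def[of s] psubst_def[of "\<lambda>v. psubst t (s v)"] psubst_sum psubst_mult
      psubst_pconst psubst_prod psubst_power)

lemma rsubst_Fract:
  assumes inj: "inj (psubst s)" and "q \<noteq> 0"
  shows "rsubst s (Fract p q) = Fract (psubst s p) (psubst s q)"
  unfolding rsubst_def
proof (rule the_equality)
  show "\<exists>p' q'. q' \<noteq> 0 \<and> Fract p q = Fract p' q' \<and>
      Fract (psubst s p) (psubst s q) = Fract (psubst s p') (psubst s q')"
    using assms(2) by blast
next
  have nz: "psubst s r \<noteq> 0" if "r \<noteq> 0" for r
    using inj that psubst_zero[of s] by (metis injD)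
  fix y assume "\<exists>p' q'. q' \<noteq> 0 \<and> Fract p q = Fract p' q' \<and> y = Fract (psubst s p') (psubst s q')"
  then obtain p' q' where *: "q' \<noteq> 0" "Fract p q = Fract p' q'"
    "y = Fract (psubst s p') (psubst s q')" by blast
  then have "p * q' = p' * q" using assms(2) by (simp add: eq_fract)
  then have "psubst s p * psubst s q' = psubst s p' * psubst s q"
    by (metis psubst_mult)
  then show "y = Fract (psubst s p) (psubst s q)"
    using * assms(2) nz by (simp add: eq_fract)
qed

lemma inj_psubst_if_inverse:
  assumes "\<And>v. psubst t (s v) = pvar v"
  shows "inj (psubst s)"
  by (rule inj_on_inverseI[where g = "psubst t"])
     (simp add: psubst_psubst assms psubst_pvar_id)

lemma rsubst_hom:
  assumes inj: "inj (psubst s)"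
  shows "rsubst s (f + g) = rsubst s f + rsubst s g"
    and "rsubst s (f * g) = rsubst s f * rsubst s g"
    and "rsubst s (rconst c) = rconst c"
    and "rsubst s (rvar v) = Fract (s v) 1"
proof -
  have nz: "psubst s r \<noteq> 0" if "r \<noteq> 0" for r
    using inj that psubst_zero[of s] by (metis injD)
  obtain p q where f: "f = Fract p q" "q \<noteq> 0" by (cases f) auto
  obtain p' q' where g: "g = Fract p' q'" "q' \<noteq> 0" by (cases g) auto
  show "rsubst s (f + g) = rsubst s f + rsubst s g"
    using f g nz by (simp add: rsubst_Fract[OF inj] psubst_add psubst_mult)
  show "rsubst s (f * g) = rsubst s f * rsubst s g"
    using f g nz by (simp add: rsubst_Fract[OF inj] psubst_mult)
  show "rsubst s (rconst c) = rconst c" "rsubst s (rvar v) = Fract (s v) 1"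
    by (simp_all add: rconst_def rvar_def rsubst_Fract[OF inj] psubst_pconst psubst_pvar psubst_one)
qed

lemma pvars_simps:
  "pvars (p + q) \<subseteq> pvars p \<union> pvars q"
  "pvars (p * q) \<subseteq> pvars p \<union> pvars q"
  "pvars (pconst c) = {}" "pvars 0 = {}" "pvars 1 = {}" "pvars (pvar v) = {v}"
  "pvars (- p) = pvars p"
proof -
  show "pvars (p + q) \<subseteq> pvars p \<union> pvars q"
    using Poly_Mapping.keys_add[of p q] by (auto simp: pvars_def)
  show "pvars (p * q) \<subseteq> pvars p \<union> pvars q"
  proof
    fix v assume "v \<in> pvars (p * q)"
    then obtain m where "m \<in> Poly_Mapping.keys (p * q)" "v \<in> Poly_Mapping.keys m"
      by (auto simp: pvars_def)
    then obtain a b where "a \<in> Poly_Mapping.keys p" "b \<in> Poly_Mapping.keys q" "m = a + b"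
      using keys_mult[of p q] by blast
    then show "v \<in> pvars p \<union> pvars q"
      using \<open>v \<in> Poly_Mapping.keys m\<close> Poly_Mapping.keys_add[of a b] by (auto simp: pvars_def)
  qed
qed (auto simp: pvars_def pconst_def pvar_def)

lemma pvars_sum: "pvars (\<Sum>i\<in>A. p i) \<subseteq> (\<Union>i\<in>A. pvars (p i))"
proof (induction A rule: infinite_finite_induct)
  case (insert x F)
  then show ?case using pvars_simps(1)[of "p x" "sum p F"] by auto
qed (simp_all add: pvars_simps)

lemma pvars_prod: "pvars (\<Prod>i\<in>A. p i) \<subseteq> (\<Union>i\<in>A. pvars (p i))"
proof (induction A rule: infinite_finite_induct)
  case (insert x F)
  then show ?case using pvars_simps(2)[of "p x" "prod p F"] by auto
qed (simp_all add: pvars_simps)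

lemma pvars_power: "pvars (p ^ n) \<subseteq> pvars p"
proof (induction n)
  case (Suc n)
  then show ?case using pvars_simps(2)[of p "p ^ n"] by auto
qed (simp add: pvars_simps)

lemma pvars_psubst: "pvars (psubst s p) \<subseteq> (\<Union>v\<in>pvars p. pvars (s v))"
proof -
  have "pvars (pconst c * (\<Prod>v\<in>Poly_Mapping.keys m. s v ^ Poly_Mapping.lookup m v))
      \<subseteq> (\<Union>v\<in>Poly_Mapping.keys m. pvars (s v))" for c m
    using pvars_simps(2)[of "pconst c" "\<Prod>v\<in>Poly_Mapping.keys m. s v ^ Poly_Mapping.lookup m v"]
      pvars_prod[of "\<lambda>v. s v ^ Poly_Mapping.lookup m v" "Poly_Mapping.keys m"] pvars_power[of "s _"]
    by (fastforce simp: pvars_simps)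
  then show ?thesis
    unfolding psubst_def
    using pvars_sum[of "\<lambda>m. pconst (Poly_Mapping.lookup p m) *
      (\<Prod>v\<in>Poly_Mapping.keys m. s v ^ Poly_Mapping.lookup m v)" "Poly_Mapping.keys p"]
    unfolding pvars_def[of p] by fastforce
qed

lemma gz_OmegaI:
  "q \<noteq> 0 \<Longrightarrow> pvars p \<subseteq> gz_index k lam \<Longrightarrow> pvars q \<subseteq> gz_index k lam \<Longrightarrow> Fract p q \<in> gz_Omega k lam"
  by (auto simp: gz_Omega_def)

lemma gz_Omega_subfield:
  shows gz_Omega_add: "f \<in> gz_Omega k lam \<Longrightarrow> g \<in> gz_Omega k lam \<Longrightarrow> f + g \<in> gz_Omega k lam"
    and gz_Omega_mult: "f \<in> gz_Omega k lam \<Longrightarrow> g \<in> gz_Omega k lam \<Longrightarrow> f * g \<in> gz_Omega k lam"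
    and gz_Omega_uminus: "f \<in> gz_Omega k lam \<Longrightarrow> - f \<in> gz_Omega k lam"
    and gz_Omega_inverse: "f \<in> gz_Omega k lam \<Longrightarrow> inverse f \<in> gz_Omega k lam"
    and gz_Omega_rconst: "rconst c \<in> gz_Omega k lam"
    and gz_Omega_rvar: "v \<in> gz_index k lam \<Longrightarrow> rvar v \<in> gz_Omega k lam"
proof -
  let ?I = "gz_index k lam"
  have mult: "pvars (p * q) \<subseteq> ?I" if "pvars p \<subseteq> ?I" "pvars q \<subseteq> ?I" for p q
    using that pvars_simps(2)[of p q] by blast
  have add: "pvars (p + q) \<subseteq> ?I" if "pvars p \<subseteq> ?I" "pvars q \<subseteq> ?I" for p q
    using that pvars_simps(1)[of p q] by blast
  show "f + g \<in> gz_Omega k lam" if fg: "f \<in> gz_Omega k lam" "g \<in> gz_Omega k lam"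
  proof -
    obtain p q p' q' where "f = Fract p q" "q \<noteq> 0" "pvars p \<subseteq> ?I" "pvars q \<subseteq> ?I"
      "g = Fract p' q'" "q' \<noteq> 0" "pvars p' \<subseteq> ?I" "pvars q' \<subseteq> ?I"
      using fg by (auto simp: gz_Omega_def)
    then show ?thesis by (simp add: gz_OmegaI add mult)
  qed
  show "f * g \<in> gz_Omega k lam" if fg: "f \<in> gz_Omega k lam" "g \<in> gz_Omega k lam"
  proof -
    obtain p q p' q' where "f = Fract p q" "q \<noteq> 0" "pvars p \<subseteq> ?I" "pvars q \<subseteq> ?I"
      "g = Fract p' q'" "q' \<noteq> 0" "pvars p' \<subseteq> ?I" "pvars q' \<subseteq> ?I"
      using fg by (auto simp: gz_Omega_def)
    then show ?thesis by (simp add: gz_OmegaI mult)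
  qed
  show "- f \<in> gz_Omega k lam" if fO: "f \<in> gz_Omega k lam"
  proof -
    obtain p q where "f = Fract p q" "q \<noteq> 0" "pvars p \<subseteq> ?I" "pvars q \<subseteq> ?I"
      using fO by (auto simp: gz_Omega_def)
    then show ?thesis by (auto intro!: gz_OmegaI simp: pvars_simps)
  qed
  show "inverse f \<in> gz_Omega k lam" if fO: "f \<in> gz_Omega k lam"
  proof -
    obtain p q where f: "f = Fract p q" "q \<noteq> 0" "pvars p \<subseteq> ?I" "pvars q \<subseteq> ?I"
      using fO by (auto simp: gz_Omega_def)
    show ?thesis
    proof (cases "p = 0")
      case True
      then have "inverse f = f" using f by (simp add: fract_collapse)
      with fO show ?thesis by simp
    next
      case False
      with f show ?thesis by (auto intro!: gz_OmegaI)
    qed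
  qed
  show "rconst c \<in> gz_Omega k lam" "v \<in> ?I \<Longrightarrow> rvar v \<in> gz_Omega k lam"
    unfolding rconst_def rvar_def by (auto intro!: gz_OmegaI simp: pvars_simps)
qed

lemma gz_Omega_zero: "0 \<in> gz_Omega k lam" and gz_Omega_one: "1 \<in> gz_Omega k lam"
  using gz_Omega_rconst[of 0 k lam] gz_Omega_rconst[of 1 k lam]
  by (simp_all add: rconst_def pconst_simps fract_collapse)

lemma gz_Omega_sum: "(\<And>i. i \<in> A \<Longrightarrow> f i \<in> gz_Omega k lam) \<Longrightarrow> (\<Sum>i\<in>A. f i) \<in> gz_Omega k lam"
  by (induction A rule: infinite_finite_induct) (simp_all add: gz_Omega_zero gz_Omega_add)

lemma gz_Omega_prod: "(\<And>i. i \<in> A \<Longrightarrow> f i \<in> gz_Omega k lam) \<Longrightarrow> (\<Prod>i\<in>A. f i) \<in> gz_Omega k lam"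
  by (induction A rule: infinite_finite_induct) (simp_all add: gz_Omega_one gz_Omega_mult)

lemma gz_Omega_diff: "f \<in> gz_Omega k lam \<Longrightarrow> g \<in> gz_Omega k lam \<Longrightarrow> f - g \<in> gz_Omega k lam"
  using gz_Omega_add[of f k lam "- g"] gz_Omega_uminus[of g k lam] by simp

lemma gz_Omega_divide: "f \<in> gz_Omega k lam \<Longrightarrow> g \<in> gz_Omega k lam \<Longrightarrow> f / g \<in> gz_Omega k lam"
  using gz_Omega_mult[of f k lam "inverse g"] gz_Omega_inverse[of g k lam] by (simp add: divide_fract_def)

lemma inj_shift: "inj (psubst (\<lambda>b. pvar b + (if a = b then pconst c else 0)))"
  by (rule inj_psubst_if_inverse[where t = "\<lambda>b. pvar b + (if a = b then pconst (- c) else 0)"])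
     (auto simp: psubst_add psubst_pvar psubst_pconst psubst_zero pconst_simps(3)[symmetric]
        pconst_simps(1) add.assoc)

lemma gz_phi_alt: "gz_phi a = rsubst (\<lambda>b. pvar b + (if a = b then pconst 1 else 0))"
  unfolding gz_phi_def pconst_simps(2) ..

lemma gz_phi_hom:
  "gz_phi a (f + g) = gz_phi a f + gz_phi a g"
  "gz_phi a (f * g) = gz_phi a f * gz_phi a g"
  "gz_phi a (rconst c) = rconst c"
  "gz_phi a (rvar b) = rvar b + (if a = b then 1 else 0)"
  unfolding gz_phi_alt
  by (simp_all only: rsubst_hom[OF inj_shift])
     (simp add: rvar_def pconst_simps One_fract_def)

lemma shift_inverse:
  "rsubst (\<lambda>b. pvar b + (if a = b then pconst (- c) else 0))
    (rsubst (\<lambda>b. pvar b + (if a = b then pconst c else 0)) f) = f"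
proof -
  let ?s = "\<lambda>c b. pvar b + (if a = b then pconst c else 0)"
  obtain p q where f: "f = Fract p q" "q \<noteq> 0" by (cases f) auto
  have "psubst (?s c) q \<noteq> 0"
    using inj_shift[of a c] f psubst_zero by (metis (no_types, lifting) injD)
  moreover have "psubst (?s (- c)) (psubst (?s c) r) = r" for r
  proof -
    have "(\<lambda>v. psubst (?s (- c)) (?s c v)) = pvar"
      by (auto simp: psubst_add psubst_pvar psubst_pconst psubst_zero pconst_simps(3)[symmetric]
          pconst_simps(1) add.assoc)
    then show ?thesis unfolding psubst_psubst by (simp add: psubst_pvar_id)
  qed
  ultimately show ?thesis
    using f by (simp add: rsubst_Fract[OF inj_shift])
qed

lemma shift_Omega:
  assumes "a \<in> gz_index k lam" "f \<in> gz_Omega k lam"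
  shows "rsubst (\<lambda>b. pvar b + (if a = b then pconst c else 0)) f \<in> gz_Omega k lam"
proof -
  let ?s = "\<lambda>b. pvar b + (if a = b then pconst c else 0)"
  obtain p q where f: "f = Fract p q" "q \<noteq> 0"
    "pvars p \<subseteq> gz_index k lam" "pvars q \<subseteq> gz_index k lam"
    using assms(2) by (auto simp: gz_Omega_def)
  have "pvars (?s v) \<subseteq> {v}" for v
    using pvars_simps(1)[of "pvar v" "if a = v then pconst c else 0"] by (auto simp: pvars_simps)
  then have "pvars (psubst ?s r) \<subseteq> pvars r" for r
    using pvars_psubst[of ?s r] by blast
  moreover have "psubst ?s q \<noteq> 0"
    using inj_shift[of a c] f psubst_zero by (metis (no_types, lifting) injD)
  ultimately show ?thesis
    using f unfolding f(1) rsubst_Fract[OF inj_shift f(2)] by (intro gz_OmegaI) (auto dest!: subsetD)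
qed

lemma bij_betw_gz_phi:
  assumes "a \<in> gz_index k lam"
  shows "bij_betw (gz_phi a) (gz_Omega k lam) (gz_Omega k lam)"
proof (rule bij_betwI[where g = "rsubst (\<lambda>b. pvar b + (if a = b then pconst (- 1) else 0))"])
  show "gz_phi a \<in> gz_Omega k lam \<rightarrow> gz_Omega k lam"
    unfolding gz_phi_alt using shift_Omega[OF assms] by blast
  show "rsubst (\<lambda>b. pvar b + (if a = b then pconst (- 1) else 0)) \<in> gz_Omega k lam \<rightarrow> gz_Omega k lam"
    using shift_Omega[OF assms] by blast
  show "rsubst (\<lambda>b. pvar b + (if a = b then pconst (- 1) else 0)) (gz_phi a x) = x" for x
    unfolding gz_phi_alt by (rule shift_inverse)
  show "gz_phi a (rsubst (\<lambda>b. pvar b + (if a = b then pconst (- 1) else 0)) x) = x" for x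
    unfolding gz_phi_alt using shift_inverse[of a "- 1" x] unfolding minus_minus .
qed

lemma gz_act_hom:
  assumes "g \<in> gz_G k lam"
  shows "gz_act k g (f + h) = gz_act k g f + gz_act k g h"
    and "gz_act k g (f * h) = gz_act k g f * gz_act k g h"
    and "gz_act k g (rconst c) = rconst c"
    and "(i, j) \<in> gz_index k lam \<Longrightarrow> gz_act k g (rvar (i, j)) = rvar (i, g i j)"
proof -
  let ?t = "\<lambda>(i, j). pvar (if i \<in> {1..k} then (i, inv (g i) j) else (i, j))"
  have "inv (g i) (g i j) = j" if "i \<in> {1..k}" for i j
    using assms that permutes_inverses(2)[of "g i" "{1..lam i}" j] by (auto simp: gz_G_def PiE_iff)
  then have "inj (psubst (\<lambda>v. pvar (gz_perm k g v)))"
    by (intro inj_psubst_if_inverse[where t = ?t])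
       (auto simp: psubst_pvar gz_perm_def split: prod.splits)
  note * = rsubst_hom[OF this, folded gz_act_def]
  show "gz_act k g (f + h) = gz_act k g f + gz_act k g h"
    and "gz_act k g (f * h) = gz_act k g f * gz_act k g h"
    and "gz_act k g (rconst c) = rconst c"
    and "(i, j) \<in> gz_index k lam \<Longrightarrow> gz_act k g (rvar (i, j)) = rvar (i, g i j)"
    using * by (auto simp: gz_perm_def gz_index_def rvar_def)
qed

text \<open>
  The generators are linear transformations of \<open>\<Omega>\<close>, and the set of all linear
  transformations of \<open>\<Omega>\<close> is itself a subalgebra, so that the hull is a genuine generated
  subalgebra.
\<close>

lemma gz_row_subset: "1 \<le> i \<Longrightarrow> i \<le> k \<Longrightarrow> gz_row lam i \<subseteq> gz_index k lam"
  by (auto simp: gz_row_def gz_index_def)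

lemma gz_generators_linear: "gz_generators k lam \<subseteq> gz_End k lam"
proof -
  let ?O = "gz_Omega k lam"
  have lin: "(\<lambda>f\<in>?O. \<Sum>j = 1..n. C j * P j f) \<in> gz_End k lam"
    if "\<And>j. j \<in> {1..n} \<Longrightarrow> C j \<in> ?O" "\<And>j f. j \<in> {1..n} \<Longrightarrow> f \<in> ?O \<Longrightarrow> P j f \<in> ?O"
      "\<And>j f g. j \<in> {1..n} \<Longrightarrow> f \<in> ?O \<Longrightarrow> g \<in> ?O \<Longrightarrow> P j (f + g) = P j f + P j g"
      "\<And>j c f. j \<in> {1..n} \<Longrightarrow> f \<in> ?O \<Longrightarrow> P j (rconst c * f) = rconst c * P j f"
    for n :: nat and C P
    using that
    by (auto simp: gz_End_def PiE_iff gz_Omega_add gz_Omega_mult gz_Omega_rconst distrib_left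
        sum.distrib[symmetric] sum_distrib_left mult_ac intro!: gz_Omega_sum sum.cong)
  have coeff: "(\<Prod>a\<in>gz_row lam i'. rvar (i, j) - rvar a) /
      (\<Prod>b\<in>gz_row lam i - {(i, j)}. rvar (i, j) - rvar b) \<in> ?O"
    if "1 \<le> i" "i \<le> k" "i' \<le> k" "j \<in> {1..lam i}" for i i' j
  proof -
    have "(i, j) \<in> gz_index k lam" using that by (auto simp: gz_index_def)
    moreover have "gz_row lam i' \<subseteq> gz_index k lam" "gz_row lam i \<subseteq> gz_index k lam"
      using that by (auto simp: gz_row_def gz_index_def)
    ultimately show ?thesis
      by (intro gz_Omega_divide gz_Omega_prod gz_Omega_diff gz_Omega_rvar) auto
  qed
  have "gz_E k lam i \<in> gz_End k lam" if "i \<in> {1..<k}" for i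
    unfolding gz_E_def
  proof (rule lin)
    fix j assume j: "j \<in> {1..lam i}"
    then have ij: "(i, j) \<in> gz_index k lam" using that by (auto simp: gz_index_def)
    show "gz_phi (i, j) f \<in> ?O" if "f \<in> ?O" for f
      using bij_betw_gz_phi[OF ij] that by (auto simp: bij_betw_def)
  qed (use that in \<open>auto intro!: coeff simp: gz_phi_hom\<close>)
  moreover have "gz_F k lam i \<in> gz_End k lam" if "i \<in> {1..<k}" for i
    unfolding gz_F_def
  proof (rule lin)
    fix j assume j: "j \<in> {1..lam i}"
    then have ij: "(i, j) \<in> gz_index k lam" using that by (auto simp: gz_index_def)
    let ?J = "inv_into ?O (gz_phi (i, j))"
    have bij: "bij_betw (gz_phi (i, j)) ?O ?O" using bij_betw_gz_phi[OF ij] .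
    show J: "?J f \<in> ?O" if "f \<in> ?O" for f
      using bij that by (metis bij_betw_def inv_into_into)
    have right: "gz_phi (i, j) (?J f) = f" if "f \<in> ?O" for f
      using bij that by (rule bij_betw_inv_into_right)
    have left: "?J f = h" if "h \<in> ?O" "gz_phi (i, j) h = f" for f h
      using bij_betw_inv_into_left[OF bij that(1)] that(2) by simp
    show "?J (f + g) = ?J f + ?J g" if "f \<in> ?O" "g \<in> ?O" for f g
      using that by (intro left) (simp_all add: gz_phi_hom right gz_Omega_add J)
    show "?J (rconst c * f) = rconst c * ?J f" if "f \<in> ?O" for f c
      using that by (intro left) (simp_all add: gz_phi_hom right gz_Omega_mult gz_Omega_rconst J)
  qed (use that in \<open>auto intro!: coeff\<close>)
  moreover have "gz_gamma k lam a \<in> gz_End k lam" if "a \<in> gz_index k lam" for a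
  proof -
    obtain i j where a: "a = (i, j)" by (cases a)
    have "elem_sym j (gz_row lam i) \<in> ?O"
      unfolding elem_sym_def
      using that a gz_row_subset[of i k lam]
      by (intro gz_Omega_sum gz_Omega_prod gz_Omega_rvar) (auto simp: gz_index_def)
    then show ?thesis
      by (auto simp: a gz_gamma_def gz_End_def PiE_iff gz_Omega_add gz_Omega_mult gz_Omega_rconst
          distrib_left algebra_simps)
  qed
  ultimately show ?thesis
    by (auto simp: gz_generators_def simp del: atLeastLessThan_iff)
qed

lemma gz_subalgebra_End: "gz_subalgebra k lam (gz_End k lam)"
  unfolding gz_subalgebra_def gz_End_def
  by (auto simp: PiE_iff compose_def gz_Omega_add gz_Omega_mult gz_Omega_rconst distrib_left mult_ac)

lemma gz_subalgebra_gz_algebra: "gz_subalgebra k lam (gz_algebra k lam)"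
proof -
  have "gz_algebra k lam \<subseteq> gz_End k lam"
    unfolding gz_algebra_def using gz_generators_linear gz_subalgebra_End by (rule hull_minimal)
  then show ?thesis
    unfolding gz_subalgebra_def[of k lam "gz_algebra k lam"]
    by (auto simp: gz_algebra_def hull_def gz_subalgebra_def)
qed

end

theory Submission
  imports Defs "HOL-Computational_Algebra.Polynomial_Factorial"
begin

text \<open>
  It suffices to treat the generators, because the transformations that preserve the invariant
  polynomials form a subalgebra.  An elementary symmetric polynomial of a row is itself
  invariant, so multiplication by it causes no trouble.  Both \<open>E\<^sub>i\<close> and \<open>F\<^sub>i\<close> have the form
  \<open>S = (\<Sum>u\<in>V. (\<Prod>a\<in>W. x\<^sub>u - x\<^sub>a) / (\<Prod>b\<in>V - {u}. x\<^sub>u - x\<^sub>b) * (f with x\<^sub>u replaced by x\<^sub>u + c))\<close>,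
  where \<open>V\<close> is the \<open>i\<close>-th row of variables, \<open>W\<close> an adjacent one (the empty row for \<open>F\<^sub>1\<close>), and
  \<open>c = 1\<close> or \<open>c = - 1\<close> (\<open>gz_op\<close>).

  A renaming of the variables that maps \<open>V\<close> and \<open>W\<close> to themselves and fixes \<open>f\<close> only permutes
  the summands, so \<open>S\<close> is again invariant (\<open>rename_gz_op\<close>).  The point is that \<open>S\<close> is a
  polynomial although its summands are not.  Its only possible poles are simple ones along the
  diagonals \<open>x\<^sub>u = x\<^sub>v\<close>, since every denominator divides the Vandermonde product of \<open>V\<close>
  (\<open>denominator_dvd_Vandermonde\<close>).  But \<open>S\<close> is unchanged when \<open>x\<^sub>u\<close> and \<open>x\<^sub>v\<close> are swapped, whereas
  \<open>x\<^sub>u - x\<^sub>v\<close> changes sign.  So \<open>(x\<^sub>u - x\<^sub>v) S\<close> is antisymmetric, vanishes on the diagonal,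
  and there is no pole (\<open>polynomial_if_swap_invariant\<close>).
\<close>

section \<open>Substitutions and divisibility\<close>

lemma psubst_diff: "psubst s (p - q) = psubst s p - psubst s q"
  using psubst_add[of s "p - q" q] by simp

lemma pvar_eq_iff: "pvar u = pvar v \<longleftrightarrow> u = v"
  by (metis pvars_simps(6) singleton_inject)

lemma dvd_prod_diff:
  fixes f g :: "'i \<Rightarrow> 'a::comm_ring_1"
  assumes "\<And>i. i \<in> A \<Longrightarrow> d dvd f i - g i"
  shows "d dvd prod f A - prod g A"
  using assms
proof (induction A rule: infinite_finite_induct)
  case (insert x A)
  have "prod f (insert x A) - prod g (insert x A)
      = (f x - g x) * prod f A + g x * (prod f A - prod g A)"
    using insert.hyps by (simp add: algebra_simps)
  then show ?case using insert by (simp add: dvd_add)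
qed auto

lemma dvd_power_diff:
  fixes a b :: "'a::comm_ring_1"
  assumes "d dvd a - b"
  shows "d dvd a ^ n - b ^ n"
  using dvd_prod_diff[of "{..<n}" d "\<lambda>_. a" "\<lambda>_. b"] assms by simp

text \<open>
  Modulo \<open>d\<close> the two substitutions agree on variables, hence on all polynomials.
\<close>

lemma dvd_psubst_diff:
  assumes "\<And>v. d dvd s v - t v"
  shows "d dvd psubst s p - psubst t p"
  unfolding psubst_def sum_subtractf[symmetric] right_diff_distrib[symmetric]
  by (intro dvd_sum dvd_mult dvd_prod_diff dvd_power_diff assms)

text \<open>
  Replacing \<open>x\<^sub>v\<close> by \<open>x\<^sub>u\<close> does not change \<open>p\<close> modulo \<open>x\<^sub>u - x\<^sub>v\<close>.
\<close>

lemma dvd_if_vanishes_on_diagonal: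
  assumes "psubst (\<lambda>w. pvar (if w = v then u else w)) p = 0"
  shows "pvar u - pvar v dvd p"
proof -
  have "pvar u - pvar v dvd psubst pvar p - psubst (\<lambda>w. pvar (if w = v then u else w)) p"
  proof (rule dvd_psubst_diff)
    show "pvar u - pvar v dvd pvar w - pvar (if w = v then u else w)" for w
      using dvd_minus_iff[of "pvar u - pvar v" "pvar u - pvar v"] by simp
  qed
  then show ?thesis using assms by (simp add: psubst_pvar_id)
qed

section \<open>Renaming and shifting of variables\<close>

definition rename :: "(gz_var \<Rightarrow> gz_var) \<Rightarrow> gz_rat \<Rightarrow> gz_rat" where
  "rename \<pi> = rsubst (\<lambda>v. pvar (\<pi> v))"

text \<open>
  The automorphisms \<open>\<phi>\<^sub>a\<close> and their inverses are the cases \<open>c = 1\<close> and \<open>c = - 1\<close>.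
\<close>

definition shift :: "gz_var \<Rightarrow> complex \<Rightarrow> gz_rat \<Rightarrow> gz_rat" where
  "shift a c = rsubst (\<lambda>b. pvar b + (if a = b then pconst c else 0))"

lemma inj_psubst_rename: "bij \<pi> \<Longrightarrow> inj (psubst (\<lambda>v. pvar (\<pi> v)))"
  by (rule inj_psubst_if_inverse[where t = "\<lambda>v. pvar (inv \<pi> v)"])
     (simp add: psubst_pvar bij_is_inj)

lemma rsubst_to_fract: "inj (psubst s) \<Longrightarrow> rsubst s (to_fract p) = to_fract (psubst s p)"
  by (simp add: to_fract_def rsubst_Fract psubst_one)

lemma rsubst_divide:
  assumes "inj (psubst s)"
  shows "rsubst s (f / g) = rsubst s f / rsubst s g"
proof (cases "g = 0")
  case True
  have "rsubst s 0 = 0"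
    using rsubst_to_fract[OF assms, of 0] by (simp add: psubst_zero)
  with True show ?thesis by simp
next
  case False
  have one: "rsubst s 1 = 1"
    using rsubst_to_fract[OF assms, of 1] by (simp add: psubst_one)
  have "rsubst s (1 / g) * rsubst s g = rsubst s (1 / g * g)"
    by (rule rsubst_hom(2)[OF assms, symmetric])
  also have "\<dots> = 1" using False one by simp
  finally have *: "rsubst s (1 / g) * rsubst s g = 1" .
  then have "rsubst s g \<noteq> 0" by auto
  with * have "rsubst s (1 / g) = 1 / rsubst s g"
    by (simp add: eq_divide_eq)
  then show ?thesis using rsubst_hom(2)[OF assms, of f "1 / g"] by simp
qed

lemma rename_to_fract: "bij \<pi> \<Longrightarrow> rename \<pi> (to_fract p) = to_fract (psubst (\<lambda>v. pvar (\<pi> v)) p)"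
  unfolding rename_def by (intro rsubst_to_fract inj_psubst_rename)

lemma shift_to_fract: "shift a c (to_fract p)
    = to_fract (psubst (\<lambda>b. pvar b + (if a = b then pconst c else 0)) p)"
  unfolding shift_def by (intro rsubst_to_fract inj_shift)

lemma rename_rvar: "bij \<pi> \<Longrightarrow> rename \<pi> (rvar v) = rvar (\<pi> v)"
  unfolding rename_def by (simp add: rsubst_hom(4)[OF inj_psubst_rename]) (simp add: rvar_def)

lemma rename_add: "bij \<pi> \<Longrightarrow> rename \<pi> (f + g) = rename \<pi> f + rename \<pi> g"
  and rename_mult: "bij \<pi> \<Longrightarrow> rename \<pi> (f * g) = rename \<pi> f * rename \<pi> g"
  unfolding rename_def by (simp_all add: rsubst_hom inj_psubst_rename)

lemma rename_zero: "bij \<pi> \<Longrightarrow> rename \<pi> 0 = 0"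
  and rename_one: "bij \<pi> \<Longrightarrow> rename \<pi> 1 = 1"
  using rename_to_fract[of \<pi> 0] rename_to_fract[of \<pi> 1] by (simp_all add: psubst_zero psubst_one)

lemma rename_diff: "bij \<pi> \<Longrightarrow> rename \<pi> (f - g) = rename \<pi> f - rename \<pi> g"
  using rename_add[of \<pi> "f - g" g] by simp

lemma rename_divide: "bij \<pi> \<Longrightarrow> rename \<pi> (f / g) = rename \<pi> f / rename \<pi> g"
  unfolding rename_def by (intro rsubst_divide inj_psubst_rename)

lemma shift_divide: "shift a c (f / g) = shift a c f / shift a c g"
  unfolding shift_def by (intro rsubst_divide inj_shift)

lemma rename_sum: "bij \<pi> \<Longrightarrow> rename \<pi> (\<Sum>i\<in>A. f i) = (\<Sum>i\<in>A. rename \<pi> (f i))"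
  by (induction A rule: infinite_finite_induct) (simp_all add: rename_zero rename_add)

lemma rename_prod: "bij \<pi> \<Longrightarrow> rename \<pi> (\<Prod>i\<in>A. f i) = (\<Prod>i\<in>A. rename \<pi> (f i))"
  by (induction A rule: infinite_finite_induct) (simp_all add: rename_one rename_mult)

lemma rename_shift:
  assumes "bij \<pi>"
  shows "rename \<pi> (shift a c f) = shift (\<pi> a) c (rename \<pi> f)"
proof -
  obtain p q where f: "f = to_fract p / to_fract q"
    by (cases f) (auto simp: Fract_conv_to_fract)
  have "psubst (\<lambda>v. pvar (\<pi> v)) (psubst (\<lambda>b. pvar b + (if a = b then pconst c else 0)) r)
      = psubst (\<lambda>b. pvar b + (if \<pi> a = b then pconst c else 0)) (psubst (\<lambda>v. pvar (\<pi> v)) r)" for r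
    unfolding psubst_psubst psubst_pvar
    by (rule arg_cong[where f = "\<lambda>s. psubst s r"])
       (auto simp: fun_eq_iff psubst_add psubst_pvar psubst_pconst psubst_zero
         inj_eq[OF bij_is_inj[OF assms]])
  then have "rename \<pi> (shift a c (to_fract r)) = shift (\<pi> a) c (rename \<pi> (to_fract r))" for r
    by (simp only: shift_to_fract rename_to_fract[OF assms])
  then show ?thesis
    unfolding f by (simp only: shift_divide rename_divide[OF assms])
qed

section \<open>Simple poles cancel\<close>

text \<open>
  The factors of the common denominator are removed one at a time.  Write
  \<open>S = N / (l q)\<close> with \<open>l = x\<^sub>u - x\<^sub>v\<close> and \<open>q\<close> the product of the remaining factors, and let \<open>\<tau>\<close>
  swap \<open>x\<^sub>u\<close> and \<open>x\<^sub>v\<close>.  As \<open>\<tau>\<close> fixes \<open>S\<close> and negates \<open>l\<close>, it follows that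
  \<open>N \<tau>(q) = - \<tau>(N) q\<close>.  On the diagonal \<open>x\<^sub>u = x\<^sub>v\<close>, where \<open>\<tau>\<close> acts trivially, this gives
  \<open>N q = - N q\<close>, and since \<open>q\<close> does not vanish there, \<open>N\<close> does.  So \<open>l\<close> divides \<open>N\<close>, and
  \<open>q\<close> is a denominator of \<open>S\<close>.
  The condition \<open>u < v\<close> ensures that each diagonal occurs only once.
\<close>

lemma polynomial_if_swap_invariant:
  assumes "finite T"
    and "\<And>u v. (u, v) \<in> T \<Longrightarrow> u < v"
    and "\<And>u v. (u, v) \<in> T \<Longrightarrow> rename (transpose u v) S = S"
    and "S * to_fract (\<Prod>(u, v)\<in>T. pvar u - pvar v) \<in> range to_fract"
  shows "S \<in> range to_fract"
  using assms
proof (induction T rule: finite_induct)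
  case (insert t T)
  obtain u v where t: "t = (u, v)" by (cases t)
  with insert.prems(1) have uv: "u < v" by auto
  define l where "l = pvar u - pvar v"
  define q where "q = (\<Prod>(u, v)\<in>T. pvar u - pvar v)"
  define \<tau> where "\<tau> = psubst (\<lambda>w. pvar (transpose u v w))"
  define \<sigma> where "\<sigma> = psubst (\<lambda>w. pvar (if w = v then u else w))"
  \<comment> \<open>\<open>\<sigma>\<close> is restriction to the diagonal, which the swap fixes pointwise.\<close>
  have \<sigma>\<tau>: "\<sigma> (\<tau> p) = \<sigma> p" for p
    unfolding \<sigma>_def \<tau>_def psubst_psubst psubst_pvar
    by (rule arg_cong[where f = "\<lambda>s. psubst s p"]) (auto simp: transpose_def)
  have \<tau>: "rename (transpose u v) (to_fract p) = to_fract (\<tau> p)" for p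
    unfolding \<tau>_def by (simp add: rename_to_fract)
  obtain N where N: "S * to_fract (l * q) = to_fract N"
    using insert.prems(3) insert.hyps by (auto simp: t l_def q_def)
  have "\<tau> l = - l"
    by (simp add: \<tau>_def l_def psubst_diff psubst_pvar)
  then have \<tau>N: "S * to_fract (- l * \<tau> q) = to_fract (\<tau> N)"
    using arg_cong[OF N, of "rename (transpose u v)"] insert.prems(2)[of u v]
    by (simp only: rename_mult bij_transpose \<tau> t insertI1)
       (simp add: \<tau>_def psubst_mult)
  have "to_fract (N * \<tau> q) = to_fract (- (\<tau> N * q))"
    unfolding to_fract_mult to_fract_uminus N[symmetric] \<tau>N[symmetric] by simp
  then have "N * \<tau> q = - (\<tau> N * q)" by (simp only: to_fract_eq_iff)
  from arg_cong[OF this, of \<sigma>] have "\<sigma> N * \<sigma> (\<tau> q) + \<sigma> (\<tau> N) * \<sigma> q = 0"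
    unfolding \<sigma>_def by (simp add: psubst_mult[symmetric] psubst_add[symmetric] psubst_zero)
  then have eq: "\<sigma> N * \<sigma> q + \<sigma> N * \<sigma> q = 0" by (simp add: \<sigma>\<tau>)
  \<comment> \<open>Twice a polynomial is zero only if the polynomial is, as one sees on coefficients.\<close>
  have "\<sigma> N * \<sigma> q = 0"
  proof (rule poly_mapping_eqI)
    fix m
    show "Poly_Mapping.lookup (\<sigma> N * \<sigma> q) m = Poly_Mapping.lookup 0 m"
      using arg_cong[OF eq, of "\<lambda>p. Poly_Mapping.lookup p m"] unfolding lookup_add by simp
  qed
  moreover have "\<sigma> q \<noteq> 0"
  proof -
    have "finite T" using insert.hyps by simp
    \<comment> \<open>A factor of \<open>q\<close> vanishes on the diagonal only if its pair is \<open>{u, v}\<close>, whose ordered form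
      \<open>(u, v)\<close> is not in \<open>T\<close>.\<close>
    moreover have "(if a = v then u else a) \<noteq> (if b = v then u else b)" if "(a, b) \<in> T" for a b
      using that insert.prems(1)[of a b] insert.hyps(2) uv by (auto simp: t)
    ultimately show ?thesis
      by (auto simp: \<sigma>_def q_def psubst_prod psubst_diff psubst_pvar pvar_eq_iff case_prod_unfold)
  qed
  ultimately have "\<sigma> N = 0" by simp
  then have "l dvd N"
    unfolding l_def \<sigma>_def by (rule dvd_if_vanishes_on_diagonal)
  then obtain M where M: "N = l * M" by auto
  have "l \<noteq> 0" using uv by (simp add: l_def pvar_eq_iff)
  then have "S * to_fract q = to_fract M"
    using N by (simp add: M mult.left_commute[of S])
  then show ?case
    using insert by (auto simp: q_def)
qed auto

text \<open>
  Up to sign, the factors on the left are those factors on the right that involve \<open>u\<close>, and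
  each of them occurs once.
\<close>

lemma denominator_dvd_Vandermonde:
  assumes "finite V" "u \<in> V"
  shows "(\<Prod>b\<in>V - {u}. pvar u - pvar b) dvd
    (\<Prod>(a, b)\<in>{(a, b). a \<in> V \<and> b \<in> V \<and> a < b}. pvar a - pvar b)"
proof -
  let ?T = "{(a, b). a \<in> V \<and> b \<in> V \<and> a < b}"
  let ?l = "\<lambda>(a, b). pvar a - pvar b"
  let ?o = "\<lambda>b. (min u b, max u b)"
  have inj: "inj_on ?o (V - {u})"
    by (auto simp: inj_on_def min_def max_def split: if_splits)
  have "(\<Prod>b\<in>V - {u}. pvar u - pvar b) dvd (\<Prod>b\<in>V - {u}. ?l (?o b))"
  proof (rule prod_dvd_prod)
    show "pvar u - pvar b dvd ?l (?o b)" for b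
      using dvd_minus_iff[of "pvar u - pvar b" "pvar u - pvar b"] by (simp add: min_def max_def)
  qed
  also have "\<dots> = prod ?l (?o ` (V - {u}))"
    using prod.reindex[OF inj, of ?l] by (simp add: comp_def)
  also have "\<dots> dvd prod ?l ?T"
  proof (rule prod_dvd_prod_subset)
    show "finite ?T"
      by (rule finite_subset[of _ "V \<times> V"]) (use assms in auto)
    show "?o ` (V - {u}) \<subseteq> ?T"
      using assms by (auto simp: min_def max_def)
  qed
  finally show ?thesis .
qed

section \<open>The Gelfand-Zeitlin operators\<close>

definition gz_op :: "gz_var set \<Rightarrow> gz_var set \<Rightarrow> complex \<Rightarrow> gz_rat \<Rightarrow> gz_rat" where
  "gz_op V W c f = (\<Sum>u\<in>V. (\<Prod>a\<in>W. rvar u - rvar a) / (\<Prod>b\<in>V - {u}. rvar u - rvar b) * shift u c f)"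

text \<open>
  The renaming sends the summand of \<open>u\<close> to the summand of \<open>\<pi> u\<close>.
\<close>

lemma rename_gz_op:
  assumes \<pi>: "bij \<pi>" "\<pi> ` V = V" "\<pi> ` W = W" and f: "rename \<pi> f = f"
  shows "rename \<pi> (gz_op V W c f) = gz_op V W c f"
proof -
  have inj: "inj_on \<pi> A" for A using bij_is_inj[OF \<pi>(1)] by (rule inj_on_subset) simp
  have num: "(\<Prod>a\<in>W. rvar (\<pi> u) - rvar (\<pi> a)) = (\<Prod>a\<in>W. rvar (\<pi> u) - rvar a)" for u
    using prod.reindex[OF inj, of "\<lambda>a. rvar (\<pi> u) - rvar a" W] \<pi>(3) by (simp add: comp_def)
  have den: "(\<Prod>b\<in>V - {u}. rvar (\<pi> u) - rvar (\<pi> b)) = (\<Prod>b\<in>V - {\<pi> u}. rvar (\<pi> u) - rvar b)" for u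
    using prod.reindex[OF inj, of "\<lambda>b. rvar (\<pi> u) - rvar b" "V - {u}"] \<pi>(2)
      image_set_diff[OF bij_is_inj[OF \<pi>(1)], of V "{u}"] by (simp add: comp_def)
  have "rename \<pi> (gz_op V W c f) = (\<Sum>u\<in>V. (\<Prod>a\<in>W. rvar (\<pi> u) - rvar a) /
      (\<Prod>b\<in>V - {\<pi> u}. rvar (\<pi> u) - rvar b) * shift (\<pi> u) c f)"
    by (simp add: gz_op_def rename_sum rename_prod rename_mult rename_divide rename_diff
        rename_rvar rename_shift \<pi>(1) f num den)
  also have "\<dots> = gz_op V W c f"
    unfolding gz_op_def using sum.reindex[OF inj, of "\<lambda>u. (\<Prod>a\<in>W. rvar u - rvar a) /
      (\<Prod>b\<in>V - {u}. rvar u - rvar b) * shift u c f" V] \<pi>(2) by (simp add: comp_def)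
  finally show ?thesis .
qed

lemma to_fract_sum: "to_fract (\<Sum>i\<in>A. f i) = (\<Sum>i\<in>A. to_fract (f i))"
  by (induction A rule: infinite_finite_induct) simp_all

lemma to_fract_prod: "to_fract (\<Prod>i\<in>A. f i) = (\<Prod>i\<in>A. to_fract (f i))"
  by (induction A rule: infinite_finite_induct) simp_all

lemma gz_op_polynomial:
  assumes "finite V"
    and swap: "\<And>u v. u \<in> V \<Longrightarrow> v \<in> V \<Longrightarrow> rename (transpose u v) (gz_op V W c (to_fract p)) = gz_op V W c (to_fract p)"
  shows "gz_op V W c (to_fract p) \<in> range to_fract"
proof (rule polynomial_if_swap_invariant)
  let ?T = "{(a, b). a \<in> V \<and> b \<in> V \<and> a < b}"
  let ?D = "\<Prod>(a, b)\<in>?T. pvar a - pvar b"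
  show "finite ?T"
    by (rule finite_subset[of _ "V \<times> V"]) (use assms in auto)
  have rvar: "rvar v = to_fract (pvar v)" for v
    by (simp add: rvar_def to_fract_def)
  let ?h = "\<lambda>u. (\<Prod>a\<in>W. pvar u - pvar a) * psubst (\<lambda>b. pvar b + (if u = b then pconst c else 0)) p"
  let ?d = "\<lambda>u. \<Prod>b\<in>V - {u}. pvar u - pvar b"
  have "\<forall>u\<in>V. \<exists>e. ?D = ?d u * e"
    using denominator_dvd_Vandermonde[OF assms(1)] unfolding dvd_def by blast
  then have "\<exists>e. \<forall>u\<in>V. ?D = ?d u * e u" by (rule bchoice)
  then obtain e where e: "\<And>u. u \<in> V \<Longrightarrow> ?D = ?d u * e u" by blast
  have cancel: "to_fract (?h u) / to_fract (?d u) * to_fract ?D = to_fract (?h u * e u)" if "u \<in> V" for u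
  proof -
    have "?d u \<noteq> 0" using assms(1) by (auto simp: pvar_eq_iff)
    then show ?thesis by (simp only: e[OF that] to_fract_mult) simp
  qed
  have "gz_op V W c (to_fract p) * to_fract ?D
      = (\<Sum>u\<in>V. to_fract (?h u) / to_fract (?d u) * to_fract ?D)"
    by (simp add: gz_op_def rvar shift_to_fract to_fract_prod sum_distrib_right)
  also have "\<dots> = to_fract (\<Sum>u\<in>V. ?h u * e u)"
    by (simp only: cancel to_fract_sum cong: sum.cong)
  finally show "gz_op V W c (to_fract p) * to_fract ?D \<in> range to_fract" by (rule range_eqI)
qed (use swap in auto)

section \<open>Invariant polynomials\<close>

text \<open>
  If a polynomial \<open>p\<close> equals \<open>a / b\<close> with \<open>a\<close> and \<open>b\<close> in the variables indexed by \<open>I\<close>, then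
  setting all other variables to zero fixes \<open>a\<close> and \<open>b\<close>, hence also \<open>p\<close>.  Polynomials that
  arise as quotients below therefore involve no variables outside \<open>I\<close>.
\<close>

lemma polynomial_in_Omega:
  assumes "to_fract p \<in> gz_Omega k lam"
  shows "to_fract p \<in> gz_R k lam"
proof -
  let ?e = "psubst (\<lambda>v. if v \<in> gz_index k lam then pvar v else 0)"
  have vars: "pvars (?e r) \<subseteq> gz_index k lam" for r
    using pvars_psubst[of "\<lambda>v. if v \<in> gz_index k lam then pvar v else 0" r]
    by (auto simp: pvars_simps split: if_splits)
  have fixed: "?e r = r" if "pvars r \<subseteq> gz_index k lam" for r
  proof -
    have "?e r = psubst pvar r"
      unfolding psubst_def using that
      by (intro sum.cong prod.cong arg_cong2[where f = "(*)"]) (auto simp: pvars_def)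
    then show ?thesis by (simp add: psubst_pvar_id)
  qed
  obtain a b where ab: "to_fract p = Fract a b" "b \<noteq> 0"
    "pvars a \<subseteq> gz_index k lam" "pvars b \<subseteq> gz_index k lam"
    using assms by (auto simp: gz_Omega_def)
  then have pb: "p * b = a" by (simp add: to_fract_def eq_fract)
  have "?e p * b = ?e (p * b)" by (simp only: psubst_mult fixed[OF ab(4)])
  also have "\<dots> = p * b" by (simp only: pb fixed[OF ab(3)])
  finally have "?e p * b = p * b" .
  then have "?e p = p" using ab by simp
  with vars[of p] show ?thesis by (auto simp: gz_R_def to_fract_def)
qed

lemma gz_act_rename: "gz_act k g = rename (gz_perm k g)"
  unfolding gz_act_def rename_def ..

lemma bij_gz_perm:
  assumes "g \<in> gz_G k lam"
  shows "bij (gz_perm k g)"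
proof (rule o_bij)
  let ?h = "gz_perm k (\<lambda>i. inv (g i))"
  have perm: "g i permutes {1..lam i}" if "i \<in> {1..k}" for i
    using assms that by (auto simp: gz_G_def PiE_iff)
  show "?h \<circ> gz_perm k g = id" "gz_perm k g \<circ> ?h = id"
    using permutes_inverses[OF perm] by (auto simp: fun_eq_iff gz_perm_def)
qed

lemma gz_perm_row:
  assumes "g \<in> gz_G k lam" "i \<le> k"
  shows "gz_perm k g ` gz_row lam i = gz_row lam i"
proof (cases "i = 0")
  case False
  then have "g i permutes {1..lam i}"
    using assms by (auto simp: gz_G_def PiE_iff)
  then have "g i ` {1..lam i} = {1..lam i}" by (rule permutes_image)
  moreover have "gz_perm k g ` ({i} \<times> A) = {i} \<times> g i ` A" for A
    using False assms(2) by (force simp: gz_perm_def)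
  ultimately show ?thesis using False by (simp add: gz_row_def)
qed (simp add: gz_row_def)

text \<open>
  Swap invariance, from which polynomiality is deduced, is thus a case of invariance under \<open>G\<close>.
\<close>

lemma transposition_in_G:
  assumes "i \<le> k" "u \<in> gz_row lam i" "v \<in> gz_row lam i"
  obtains g where "g \<in> gz_G k lam" "gz_perm k g = transpose u v"
proof -
  obtain a b where uv: "u = (i, a)" "v = (i, b)" "a \<in> {1..lam i}" "b \<in> {1..lam i}"
    using assms by (auto simp: gz_row_def split: if_splits)
  have i: "i \<in> {1..k}" using assms by (auto simp: gz_row_def split: if_splits)
  let ?g = "\<lambda>i'\<in>{1..k}. if i' = i then transpose a b else id"
  have "?g \<in> gz_G k lam"
    using permutes_swap_id[OF uv(3,4)] permutes_id by (auto simp: gz_G_def)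
  moreover have "gz_perm k ?g = transpose u v"
    using i by (auto simp: fun_eq_iff gz_perm_def uv transpose_def)
  ultimately show ?thesis by (rule that)
qed

lemma gz_R_subset_Omega: "gz_R k lam \<subseteq> gz_Omega k lam"
  by (auto simp: gz_R_def pvars_simps intro!: gz_OmegaI)

lemma gz_invariantsD:
  assumes "f \<in> gz_invariants k lam"
  shows "f \<in> gz_Omega k lam" "f \<in> range to_fract"
    and "\<And>g. g \<in> gz_G k lam \<Longrightarrow> rename (gz_perm k g) f = f"
  using assms gz_R_subset_Omega
  by (auto simp: gz_invariants_def gz_R_def to_fract_def gz_act_rename)

lemma gz_invariantsI:
  assumes "f \<in> gz_Omega k lam" "f \<in> range to_fract"
    and "\<And>g. g \<in> gz_G k lam \<Longrightarrow> rename (gz_perm k g) f = f"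
  shows "f \<in> gz_invariants k lam"
  using assms polynomial_in_Omega by (auto simp: gz_invariants_def gz_act_rename)

lemma gz_op_invariants:
  assumes f: "f \<in> gz_invariants k lam" and i: "i \<le> k" "i' \<le> k"
    and \<Omega>: "gz_op (gz_row lam i) (gz_row lam i') c f \<in> gz_Omega k lam"
  shows "gz_op (gz_row lam i) (gz_row lam i') c f \<in> gz_invariants k lam"
proof (rule gz_invariantsI)
  let ?F = "gz_op (gz_row lam i) (gz_row lam i') c f"
  show inv: "rename (gz_perm k g) ?F = ?F" if "g \<in> gz_G k lam" for g
    using that by (intro rename_gz_op bij_gz_perm gz_perm_row i gz_invariantsD(3)[OF f])
  obtain p where p: "f = to_fract p" using gz_invariantsD(2)[OF f] by blast
  show "?F \<in> range to_fract"
    unfolding p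
  proof (rule gz_op_polynomial)
    fix u v assume "u \<in> gz_row lam i" "v \<in> gz_row lam i"
    then obtain g where "g \<in> gz_G k lam" "gz_perm k g = transpose u v"
      by (rule transposition_in_G[OF i(1)])
    then show "rename (transpose u v) (gz_op (gz_row lam i) (gz_row lam i') c (to_fract p))
        = gz_op (gz_row lam i) (gz_row lam i') c (to_fract p)"
      using inv p by metis
  qed (simp add: gz_row_def)
qed (fact \<Omega>)

lemma sum_row: "1 \<le> i \<Longrightarrow> (\<Sum>u\<in>gz_row lam i. h u) = (\<Sum>j = 1..lam i. h (i, j))"
  using sum.cartesian_product[of "\<lambda>i j. h (i, j)" "{1..lam i}" "{i}"]
  by (simp add: gz_row_def case_prod_beta')

lemma gz_E_eq_gz_op:
  assumes "f \<in> gz_Omega k lam" "1 \<le> i"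
  shows "gz_E k lam i f = gz_op (gz_row lam i) (gz_row lam (i + 1)) 1 f"
  using assms by (simp add: gz_E_def gz_op_def sum_row gz_phi_alt shift_def)

lemma gz_F_eq_gz_op:
  assumes "f \<in> gz_Omega k lam" "1 \<le> i" "i \<le> k"
  shows "gz_F k lam i f = gz_op (gz_row lam i) (gz_row lam (i - 1)) (-1) f"
proof -
  have "inv_into (gz_Omega k lam) (gz_phi (i, j)) f = shift (i, j) (-1) f" if "j \<in> {1..lam i}" for j
  proof (rule inv_into_f_eq)
    have ij: "(i, j) \<in> gz_index k lam" using that assms by (auto simp: gz_index_def)
    show "inj_on (gz_phi (i, j)) (gz_Omega k lam)"
      using bij_betw_gz_phi[OF ij] by (rule bij_betw_imp_inj_on)
    show "shift (i, j) (-1) f \<in> gz_Omega k lam"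
      unfolding shift_def using ij assms(1) by (rule shift_Omega)
    show "gz_phi (i, j) (shift (i, j) (-1) f) = f"
      unfolding gz_phi_alt shift_def using shift_inverse[of "(i, j)" "- 1" f] unfolding minus_minus .
  qed
  then show ?thesis
    using assms by (simp add: gz_F_def gz_op_def sum_row)
qed

lemma rename_elem_sym:
  assumes "bij \<pi>" "\<pi> ` V = V"
  shows "rename \<pi> (elem_sym j V) = elem_sym j V"
proof -
  have inj: "inj_on \<pi> A" for A using bij_is_inj[OF assms(1)] by (rule inj_on_subset) simp
  have "rename \<pi> (elem_sym j V) = (\<Sum>S | S \<subseteq> V \<and> card S = j. \<Prod>b\<in>\<pi> ` S. rvar b)"
    unfolding elem_sym_def
    by (simp add: rename_sum rename_prod rename_rvar assms(1) prod.reindex[OF inj])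
  also have "\<dots> = elem_sym j V"
    unfolding elem_sym_def
  proof (rule sum.reindex_bij_betw)
    show "bij_betw ((`) \<pi>) {S. S \<subseteq> V \<and> card S = j} {S. S \<subseteq> V \<and> card S = j}"
    proof (rule bij_betw_imageI)
      show "inj_on ((`) \<pi>) {S. S \<subseteq> V \<and> card S = j}"
        using bij_is_inj[OF assms(1)] by (simp add: inj_on_def inj_image_eq_iff)
      show "(`) \<pi> ` {S. S \<subseteq> V \<and> card S = j} = {S. S \<subseteq> V \<and> card S = j}"
      proof (intro subset_antisym subsetI)
        fix S assume S: "S \<in> {S. S \<subseteq> V \<and> card S = j}"
        then obtain A where "A \<subseteq> V" "S = \<pi> ` A"
          using assms(2) by (metis (no_types, lifting) mem_Collect_eq subset_imageE)
        with S show "S \<in> (`) \<pi> ` {S. S \<subseteq> V \<and> card S = j}"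
          by (auto simp: card_image[OF inj])
      qed (use assms(2) in \<open>auto simp: card_image[OF inj]\<close>)
    qed
  qed
  finally show ?thesis .
qed

lemma invariants_add:
  assumes "f \<in> gz_invariants k lam" "h \<in> gz_invariants k lam"
  shows "f + h \<in> gz_invariants k lam"
proof (rule gz_invariantsI)
  show "f + h \<in> range to_fract"
    using assms[THEN gz_invariantsD(2)] by (auto simp flip: to_fract_add)
qed (use assms in \<open>auto simp: gz_invariantsD rename_add bij_gz_perm intro!: gz_Omega_add\<close>)

lemma invariants_mult:
  assumes "f \<in> gz_invariants k lam" "h \<in> gz_invariants k lam"
  shows "f * h \<in> gz_invariants k lam"
proof (rule gz_invariantsI)
  show "f * h \<in> range to_fract"
    using assms[THEN gz_invariantsD(2)] by (auto simp flip: to_fract_mult)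
qed (use assms in \<open>auto simp: gz_invariantsD rename_mult bij_gz_perm intro!: gz_Omega_mult\<close>)

lemma invariants_rconst: "rconst c \<in> gz_invariants k lam"
proof (rule gz_invariantsI)
  show "rconst c \<in> range to_fract" by (auto simp: rconst_def to_fract_def)
  show "rename (gz_perm k g) (rconst c) = rconst c" if "g \<in> gz_G k lam" for g
    using gz_act_hom(3)[OF that] by (simp add: gz_act_rename)
qed (rule gz_Omega_rconst)

lemma elem_sym_invariant:
  assumes "i \<le> k"
  shows "elem_sym j (gz_row lam i) \<in> gz_invariants k lam"
proof (rule gz_invariantsI)
  have "gz_row lam i \<subseteq> gz_index k lam" using assms by (auto simp: gz_row_def gz_index_def)
  then show "elem_sym j (gz_row lam i) \<in> gz_Omega k lam"
    unfolding elem_sym_def by (intro gz_Omega_sum gz_Omega_prod gz_Omega_rvar) auto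
  have "elem_sym j (gz_row lam i)
      = to_fract (\<Sum>S | S \<subseteq> gz_row lam i \<and> card S = j. \<Prod>b\<in>S. pvar b)"
    unfolding elem_sym_def to_fract_sum to_fract_prod by (simp add: rvar_def to_fract_def)
  then show "elem_sym j (gz_row lam i) \<in> range to_fract" by (rule range_eqI)
  show "rename (gz_perm k g) (elem_sym j (gz_row lam i)) = elem_sym j (gz_row lam i)"
    if "g \<in> gz_G k lam" for g
    using that assms by (intro rename_elem_sym bij_gz_perm gz_perm_row)
qed

text \<open>
  The condition \<open>1 \<le> i < k\<close> on the generators \<open>E\<^sub>i\<close> and \<open>F\<^sub>i\<close> puts the neighbouring row, \<open>i + 1\<close>
  or \<open>i - 1\<close>, among the rows \<open>0, \<dots>, k\<close> that \<open>G\<close> preserves.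
\<close>

lemma generators_preserve_invariants:
  assumes u: "u \<in> gz_generators k lam" and f: "f \<in> gz_invariants k lam"
  shows "u f \<in> gz_invariants k lam"
proof -
  have fO: "f \<in> gz_Omega k lam" using f by (rule gz_invariantsD)
  have uO: "u f \<in> gz_Omega k lam"
    using gz_generators_linear u fO by (fastforce simp: gz_End_def)
  from u consider i where "i \<in> {1..<k}" "u = gz_E k lam i"
    | i where "i \<in> {1..<k}" "u = gz_F k lam i"
    | i j where "(i, j) \<in> gz_index k lam" "u = gz_gamma k lam (i, j)"
    unfolding gz_generators_def by auto
  then show ?thesis
  proof cases
    case 1
    then show ?thesis using uO gz_op_invariants[OF f, of i "i + 1" 1] gz_E_eq_gz_op[OF fO, of i]
      by simp
  next
    case 2
    then have "i - 1 \<le> k" "1 \<le> i" "i \<le> k" by auto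
    with 2 show ?thesis using uO gz_op_invariants[OF f, of i "i - 1" "-1"] gz_F_eq_gz_op[OF fO, of i]
      by simp
  next
    case 3
    then show ?thesis
      using invariants_mult[OF elem_sym_invariant f] fO by (simp add: gz_gamma_def gz_index_def)
  qed
qed

theorem proposition1:
  fixes k :: nat and lam :: "nat \<Rightarrow> nat"
  assumes "1 \<le> k"
    and "\<And>i. i \<in> {1..k} \<Longrightarrow> 1 \<le> lam i"
  shows "\<forall>u\<in>gz_algebra k lam. \<forall>f\<in>gz_invariants k lam. u f \<in> gz_invariants k lam"
proof -
  let ?B = "{T \<in> gz_End k lam. \<forall>f\<in>gz_invariants k lam. T f \<in> gz_invariants k lam}"
  let ?\<Omega> = "gz_Omega k lam"
  have "gz_subalgebra k lam ?B"
    unfolding gz_subalgebra_def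
  proof (intro conjI ballI allI)
    note End = gz_subalgebra_End[of k lam, unfolded gz_subalgebra_def]
    have in_B: "T \<in> ?B" if "T \<in> gz_End k lam"
      "\<And>f. f \<in> gz_invariants k lam \<Longrightarrow> f \<in> ?\<Omega> \<Longrightarrow> T f \<in> gz_invariants k lam" for T
      using that gz_invariantsD(1) by blast
    show "?B \<subseteq> gz_End k lam" by blast
    show "(\<lambda>f\<in>?\<Omega>. f) \<in> ?B"
    proof (rule in_B)
      show "(\<lambda>f\<in>?\<Omega>. f) \<in> gz_End k lam" using End by blast
    qed simp
    show "(\<lambda>f\<in>?\<Omega>. rconst c * T f) \<in> ?B" if "T \<in> ?B" for c T
    proof (rule in_B)
      show "(\<lambda>f\<in>?\<Omega>. rconst c * T f) \<in> gz_End k lam" using End that by blast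
    qed (use that in \<open>simp add: invariants_mult invariants_rconst\<close>)
    fix S T assume ST: "S \<in> ?B" "T \<in> ?B"
    show "(\<lambda>f\<in>?\<Omega>. S f + T f) \<in> ?B"
    proof (rule in_B)
      show "(\<lambda>f\<in>?\<Omega>. S f + T f) \<in> gz_End k lam" using End ST by blast
    qed (use ST in \<open>simp add: invariants_add\<close>)
    show "compose ?\<Omega> S T \<in> ?B"
    proof (rule in_B)
      show "compose ?\<Omega> S T \<in> gz_End k lam" using End ST by blast
    qed (use ST in \<open>simp add: compose_def\<close>)
  qed
  moreover have "gz_generators k lam \<subseteq> ?B"
    using gz_generators_linear generators_preserve_invariants by blast
  ultimately have "gz_algebra k lam \<subseteq> ?B"
    unfolding gz_algebra_def by (intro hull_minimal)
  then show ?thesis by blast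
qed

end
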